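(* Let $n\ge2$ and let $(c_i,J_i,T)$, $i=1,\dots,n$, be smooth with $c_i,T:[0,\infty)\times\mathbb R^3\to[0,\infty)$, $J_i:[0,\infty)\times\mathbb R^3\to\mathbb R^3$, solving on $(0,\infty)\times\mathbb R^3$ the system $$\partial_tc_i+\nabla_x\cdot J_i=0,\qquad \nabla_x(c_iT)=-\sum_{j\ne i}\frac{c_jJ_i-c_iJ_j}{D_{ij}}\qquad(i=1,\dots,n),$$ $$\partial_t(c_{\rm tot}T)+\frac53\nabla_x\cdot\left(T\sum_{i=1}^nJ_i\right)=0,$$ where $c_{\rm tot}:=\sum_{i=1}^nc_i>0$. Suppose that the closure relation $$\sum_{i=1}^nJ_i=-\alpha\nabla c_{\rm tot}$$ holds for some constant $\alpha>0$. Then $c_{\rm tot}$ and $T$ satisfy $$\partial_tc_{\rm tot}-\alpha\Delta c_{\rm tot}=0,$$ $$\partial_tT-\left(\frac23\,\partial_t\log c_{\rm tot}\right)T-\left(\frac{5\alpha}3\nabla\log c_{\rm tot}\right)\cdot\nabla T=0$$ on $(0,\infty)\times\mathbb R^3$.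
   Context: $D_{ij}=D_{ji}>0$ ($i\ne j$) are given constants (binary diffusion coefficients). $\nabla$ and $\Delta$ act on the space variable $x\in\mathbb R^3$. *)

theory Defs
  imports "HOL-Analysis.Analysis"
begin

text \<open>
  \<open>Ck_on k f S\<close>: \<open>f\<close> is \<open>k\<close> times continuously differentiable on \<open>S\<close>. Derivatives are taken within
  \<open>S\<close>, so they are one-sided at boundary points; they are unique when \<open>S\<close> is a half-space. Since the
  domain is finite-dimensional, it suffices to require regularity of \<open>x \<mapsto> f' x v\<close> for each fixed
  direction \<open>v\<close>.
\<close>

primrec Ck_on :: "nat \<Rightarrow> ('a::euclidean_space \<Rightarrow> 'b::real_normed_vector) \<Rightarrow> 'a set \<Rightarrow> bool" where
  "Ck_on 0 f S \<longleftrightarrow> continuous_on S f"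
| "Ck_on (Suc k) f S \<longleftrightarrow>
     (\<exists>f'. (\<forall>x\<in>S. (f has_derivative f' x) (at x within S)) \<and> (\<forall>v. Ck_on k (\<lambda>x. f' x v) S))"

definition smooth_on :: "'a::euclidean_space set \<Rightarrow> ('a \<Rightarrow> 'b::real_normed_vector) \<Rightarrow> bool" where
  "smooth_on S f \<longleftrightarrow> (\<forall>k. Ck_on k f S)"

definition partial_deriv :: "'m::finite \<Rightarrow> (real^'m \<Rightarrow> real) \<Rightarrow> real^'m \<Rightarrow> real" where
  "partial_deriv k f x = deriv (\<lambda>s. f (x + s *\<^sub>R axis k 1)) 0"

definition grad :: "(real^'m::finite \<Rightarrow> real) \<Rightarrow> real^'m \<Rightarrow> real^'m" where
  "grad f x = (\<chi> k. partial_deriv k f x)"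

definition divergence :: "(real^'m::finite \<Rightarrow> real^'m) \<Rightarrow> real^'m \<Rightarrow> real" where
  "divergence F x = (\<Sum>k\<in>UNIV. partial_deriv k (\<lambda>y. F y $ k) x)"

definition laplacian :: "(real^'m::finite \<Rightarrow> real) \<Rightarrow> real^'m \<Rightarrow> real" where
  "laplacian f x = divergence (grad f) x"

definition c_tot :: "nat \<Rightarrow> (nat \<Rightarrow> real \<Rightarrow> real^'m \<Rightarrow> real) \<Rightarrow> real \<Rightarrow> real^'m \<Rightarrow> real" where
  "c_tot n c t x = (\<Sum>i=1..n. c i t x)"

lemma partial_deriv_eq:
  assumes "(f has_derivative f') (at x)"
  shows "partial_deriv k f x = f' (axis k 1)"
proof -
  have "((\<lambda>s. f (x + s *\<^sub>R axis k 1)) has_derivative (\<lambda>s. f' (s *\<^sub>R axis k 1))) (at 0)"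
    by (rule has_derivative_compose[of "\<lambda>s. x + s *\<^sub>R axis k 1" "\<lambda>s. s *\<^sub>R axis k 1" 0 UNIV f f'])
      (auto intro!: derivative_eq_intros assms)
  moreover have "(\<lambda>s. f' (s *\<^sub>R axis k 1)) = (*) (f' (axis k 1))"
    using linear_scale[OF has_derivative_linear[OF assms]] by (auto simp: mult.commute)
  ultimately show ?thesis
    unfolding partial_deriv_def by (intro DERIV_imp_deriv) (simp add: has_field_derivative_def)
qed

lemma grad_eq:
  assumes "GDERIV f x :> D"
  shows "grad f x = D"
  using partial_deriv_eq[OF assms[unfolded gderiv_def]]
  by (simp add: grad_def vec_eq_iff inner_axis')

end

theory Submission
  imports Defs
begin

text \<open>
  Write \<open>u\<close> for the total concentration and \<open>G\<close> for the total flux. Adding the mass balances gives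
  \<open>\<partial>\<^sub>t u + div G = 0\<close>, which the closure relation \<open>G = - \<alpha> \<nabla>u\<close> turns into the heat equation.
  The product rule in the energy balance gives
  \<open>u \<partial>\<^sub>t T + T \<partial>\<^sub>t u + 5/3 (T div G + \<nabla>T \<bullet> G) = 0\<close>. Replacing \<open>div G\<close> by \<open>- \<partial>\<^sub>t u\<close> leaves
  \<open>1 - 5/3 = - 2/3\<close> as the coefficient of \<open>T \<partial>\<^sub>t u\<close>, replacing \<open>G\<close> by \<open>- \<alpha> \<nabla>u\<close> produces the
  transport term, and division by \<open>u > 0\<close> turns the derivatives of \<open>u\<close> into derivatives of \<open>ln u\<close>.

  The remaining work is to pass from joint smoothness on the closed half-space to
  differentiability in \<open>t\<close> and in \<open>x\<close> separately at interior points
  (\<open>smooth_half_space_slices\<close>), and to obtain the rules of vector calculus for \<open>grad\<close> and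
  \<open>divergence\<close>, which are defined coordinatewise, from the Frechet derivative
  (\<open>divergence_eq\<close>, \<open>has_derivative_grad\<close>).
\<close>

lemma smooth_on_differentiable_at:
  assumes "smooth_on S f" "p \<in> interior S"
  shows "f differentiable at p"
proof -
  have "Ck_on (Suc 0) f S"
    using assms(1) by (simp only: smooth_on_def)
  then obtain f' where "\<forall>q\<in>S. (f has_derivative f' q) (at q within S)"
    by auto
  then have "(f has_derivative f' p) (at p within S)"
    using subsetD[OF interior_subset assms(2)] by simp
  then show ?thesis
    unfolding differentiable_def at_within_interior[OF assms(2)] by blast
qed

text \<open>
  At a positive time the point lies in the interior of the half-space, so the one-sided derivative
  there is an ordinary one; composing with the affine maps \<open>s \<mapsto> (s, x)\<close> and \<open>y \<mapsto> (t, y)\<close> gives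
  differentiability in each variable.
\<close>

lemma smooth_half_space_slices:
  fixes f :: "real \<Rightarrow> 'a::euclidean_space \<Rightarrow> 'b::real_normed_vector"
  assumes "smooth_on ({0..} \<times> UNIV) (\<lambda>(t, x). f t x)" "t > 0"
  shows "(\<lambda>s. f s x) differentiable at t" "f t differentiable at x"
proof -
  have "(t, x) \<in> interior ({0..} \<times> UNIV)"
    using assms(2) by (simp add: interior_Times)
  then have d: "(\<lambda>(t, x). f t x) differentiable at (t, x)"
    by (rule smooth_on_differentiable_at[OF assms(1)])
  have "(\<lambda>s. (s, x)) differentiable at t" "(\<lambda>y. (t, y)) differentiable at x"
    by (auto simp: differentiable_def intro!: derivative_eq_intros)
  then show "(\<lambda>s. f s x) differentiable at t" "f t differentiable at x"
    using differentiable_chain_at[of "\<lambda>s. (s, x)" t "\<lambda>(t, x). f t x"]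
      differentiable_chain_at[of "\<lambda>y. (t, y)" x "\<lambda>(t, x). f t x"] d
    by (simp_all add: o_def)
qed

lemma has_derivative_grad:
  fixes f :: "real^'m \<Rightarrow> real"
  assumes "f differentiable at x"
  shows "(f has_derivative (\<lambda>h. grad f x \<bullet> h)) (at x)"
proof -
  obtain f' where f': "(f has_derivative f') (at x)"
    using assms by (auto simp: differentiable_def)
  have "f' h = grad f x \<bullet> h" for h
  proof -
    have "f' h = f' (\<Sum>k\<in>UNIV. h $ k *\<^sub>R axis k 1)"
      by (simp only: basis_expansion[of h, unfolded scalar_mult_eq_scaleR])
    also have "\<dots> = (\<Sum>k\<in>UNIV. h $ k * f' (axis k 1))"
      using has_derivative_linear[OF f'] by (simp add: linear_sum linear_scale)
    also have "\<dots> = grad f x \<bullet> h"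
      by (simp add: inner_vec_def grad_def partial_deriv_eq[OF f'] mult.commute)
    finally show ?thesis .
  qed
  then show ?thesis
    using f' by (metis ext)
qed

lemma divergence_eq:
  fixes F :: "real^'m \<Rightarrow> real^'m"
  assumes "(F has_derivative F') (at x)"
  shows "divergence F x = (\<Sum>k\<in>UNIV. F' (axis k 1) $ k)"
proof -
  have "partial_deriv k (\<lambda>y. F y $ k) x = F' (axis k 1) $ k" for k
    by (rule partial_deriv_eq) (rule bounded_linear.has_derivative[OF bounded_linear_vec_nth assms])
  then show ?thesis
    by (simp add: divergence_def)
qed

lemma divergence_sum:
  fixes F :: "'i \<Rightarrow> real^'m \<Rightarrow> real^'m"
  assumes "\<And>i. i \<in> I \<Longrightarrow> F i differentiable at x"
  shows "divergence (\<lambda>y. \<Sum>i\<in>I. F i y) x = (\<Sum>i\<in>I. divergence (F i) x)"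
proof -
  have d: "(F i has_derivative frechet_derivative (F i) (at x)) (at x)" if "i \<in> I" for i
    using assms[OF that] frechet_derivative_works by blast
  have "divergence (\<lambda>y. \<Sum>i\<in>I. F i y) x
      = (\<Sum>k\<in>UNIV. \<Sum>i\<in>I. frechet_derivative (F i) (at x) (axis k 1) $ k)"
    using divergence_eq[OF has_derivative_sum[of I F, OF d]] by simp
  also have "\<dots> = (\<Sum>i\<in>I. divergence (F i) x)"
    using divergence_eq[OF d] by (simp add: sum.swap[of _ I])
  finally show ?thesis .
qed

lemma divergence_scaleR:
  fixes F :: "real^'m \<Rightarrow> real^'m"
  assumes f: "f differentiable at x" and F: "F differentiable at x"
  shows "divergence (\<lambda>y. f y *\<^sub>R F y) x = f x * divergence F x + grad f x \<bullet> F x"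
proof -
  have d: "(F has_derivative frechet_derivative F (at x)) (at x)"
    using F frechet_derivative_works by blast
  show ?thesis
    using divergence_eq[OF has_derivative_scaleR[OF has_derivative_grad[OF f] d]] divergence_eq[OF d]
    by (simp add: sum.distrib sum_distrib_left inner_axis inner_vec_def[of "grad f x" "F x"])
qed

lemma grad_ln:
  fixes f :: "real^'m \<Rightarrow> real"
  assumes "f differentiable at x" "f x > 0"
  shows "grad (\<lambda>y. ln (f y)) x = grad f x /\<^sub>R f x"
  by (rule grad_eq)
    (use assms in \<open>auto simp: gderiv_def divide_inverse inner_commute mult.commute
      intro!: derivative_eq_intros has_derivative_grad\<close>)

theorem lemma2:
  fixes n :: nat
    and D :: "nat \<Rightarrow> nat \<Rightarrow> real"
    and \<alpha> :: real
    and c :: "nat \<Rightarrow> real \<Rightarrow> real^3 \<Rightarrow> real"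
    and J :: "nat \<Rightarrow> real \<Rightarrow> real^3 \<Rightarrow> real^3"
    and T :: "real \<Rightarrow> real^3 \<Rightarrow> real"
  assumes n: "n \<ge> 2"
    and D: "\<And>i j. i \<in> {1..n} \<Longrightarrow> j \<in> {1..n} \<Longrightarrow> i \<noteq> j \<Longrightarrow> D i j = D j i \<and> D i j > 0"
    and smooth_c: "\<And>i. i \<in> {1..n} \<Longrightarrow> smooth_on ({0..} \<times> UNIV) (\<lambda>(t, x). c i t x)"
    and smooth_J: "\<And>i. i \<in> {1..n} \<Longrightarrow> smooth_on ({0..} \<times> UNIV) (\<lambda>(t, x). J i t x)"
    and smooth_T: "smooth_on ({0..} \<times> UNIV) (\<lambda>(t, x). T t x)"
    and c_nonneg: "\<And>i t x. i \<in> {1..n} \<Longrightarrow> t \<ge> 0 \<Longrightarrow> c i t x \<ge> 0"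
    and T_nonneg: "\<And>t x. t \<ge> 0 \<Longrightarrow> T t x \<ge> 0"
    and mass: "\<And>i t x. i \<in> {1..n} \<Longrightarrow> t > 0 \<Longrightarrow>
      deriv (\<lambda>s. c i s x) t + divergence (J i t) x = 0"
    and maxwell_stefan: "\<And>i t x. i \<in> {1..n} \<Longrightarrow> t > 0 \<Longrightarrow>
      grad (\<lambda>y. c i t y * T t y) x =
        - (\<Sum>j\<in>{1..n} - {i}. (c j t x *\<^sub>R J i t x - c i t x *\<^sub>R J j t x) /\<^sub>R D i j)"
    and energy: "\<And>t x. t > 0 \<Longrightarrow>
      deriv (\<lambda>s. c_tot n c s x * T s x) t
        + 5/3 * divergence (\<lambda>y. T t y *\<^sub>R (\<Sum>i=1..n. J i t y)) x = 0"
    and c_tot_pos: "\<And>t x. t > 0 \<Longrightarrow> c_tot n c t x > 0"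
    and \<alpha>: "\<alpha> > 0"
    and closure_relation: "\<And>t x. t > 0 \<Longrightarrow> (\<Sum>i=1..n. J i t x) = - \<alpha> *\<^sub>R grad (c_tot n c t) x"
  shows "\<forall>t>0. \<forall>x.
      deriv (\<lambda>s. c_tot n c s x) t - \<alpha> * laplacian (c_tot n c t) x = 0 \<and>
      deriv (\<lambda>s. T s x) t
        - (2/3 * deriv (\<lambda>s. ln (c_tot n c s x)) t) * T t x
        - ((5 * \<alpha> / 3) *\<^sub>R grad (\<lambda>y. ln (c_tot n c t y)) x) \<bullet> grad (T t) x = 0"
proof (intro allI impI)
  fix t :: real and x :: "real^3"
  assume t: "t > 0"
  define u where "u = c_tot n c"
  define G where "G y = (\<Sum>i=1..n. J i t y)" for y
  have u_eq: "u = (\<lambda>s y. \<Sum>i=1..n. c i s y)"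
    by (simp add: u_def c_tot_def fun_eq_iff)
  have ct: "(\<lambda>s. c i s x) differentiable at t" and cx: "c i t differentiable at x"
    and Jx: "J i t differentiable at x" if "i \<in> {1..n}" for i
    using smooth_half_space_slices[OF smooth_c[OF that] t]
      smooth_half_space_slices[OF smooth_J[OF that] t] by blast+
  have Tt: "(\<lambda>s. T s x) differentiable at t" and Tx: "T t differentiable at x"
    using smooth_half_space_slices[OF smooth_T t] by blast+
  have ux: "u t differentiable at x" and Gx: "G differentiable at x"
    unfolding u_eq G_def[abs_def] using cx Jx by (auto intro!: differentiable_sum)
  have upos: "u t x > 0"
    using c_tot_pos[OF t] by (simp add: u_def)
  have DT: "((\<lambda>s. T s x) has_real_derivative deriv (\<lambda>s. T s x) t) (at t)"
    using Tt by (simp add: DERIV_deriv_iff_real_differentiable)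
  have Dc: "((\<lambda>s. c i s x) has_real_derivative deriv (\<lambda>s. c i s x) t) (at t)"
    if "i \<in> {1..n}" for i
    using ct[OF that] by (simp add: DERIV_deriv_iff_real_differentiable)
  have "((\<lambda>s. u s x) has_real_derivative (\<Sum>i=1..n. deriv (\<lambda>s. c i s x) t)) (at t)"
    unfolding u_eq by (rule DERIV_sum) (rule Dc)
  moreover have "(\<Sum>i=1..n. deriv (\<lambda>s. c i s x) t) = - divergence G x"
  proof -
    have "(\<Sum>i=1..n. deriv (\<lambda>s. c i s x) t) = (\<Sum>i=1..n. - divergence (J i t) x)"
      using mass[OF _ t] by (intro sum.cong) (auto simp: eq_neg_iff_add_eq_0)
    moreover have "divergence G x = (\<Sum>i=1..n. divergence (J i t) x)"
      unfolding G_def[abs_def] by (rule divergence_sum) (rule Jx)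
    ultimately show ?thesis
      by (simp add: sum_negf)
  qed
  ultimately have Du: "((\<lambda>s. u s x) has_real_derivative - divergence G x) (at t)"
    by simp
  have G_closure: "G y = - \<alpha> *\<^sub>R grad (u t) y" for y
    using closure_relation[OF t] by (simp add: G_def u_def)
  \<comment> \<open>The closure relation, read backwards, shows that \<open>grad (u t)\<close> is differentiable: it is a
    multiple of the flux.\<close>
  have "grad (u t) = (\<lambda>y. (- 1 / \<alpha>) *\<^sub>R G y)"
    using \<alpha> by (simp add: G_closure fun_eq_iff)
  moreover have "grad (\<lambda>y::real^3. - 1 / \<alpha>) x = 0"
    by (rule grad_eq) (rule GDERIV_const)
  ultimately have lap: "laplacian (u t) x = (- 1 / \<alpha>) * divergence G x"
    using divergence_scaleR[of "\<lambda>_. - 1 / \<alpha>" x G] Gx by (simp add: laplacian_def)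
  have heat: "deriv (\<lambda>s. u s x) t - \<alpha> * laplacian (u t) x = 0"
    using DERIV_imp_deriv[OF Du] lap \<alpha> by simp
  have "deriv (\<lambda>s. u s x * T s x) t = - divergence G x * T t x + deriv (\<lambda>s. T s x) t * u t x"
    by (rule DERIV_imp_deriv) (rule DERIV_mult[OF Du DT])
  moreover have "divergence (\<lambda>y. T t y *\<^sub>R G y) x = T t x * divergence G x + grad (T t) x \<bullet> G x"
    by (rule divergence_scaleR[OF Tx Gx])
  ultimately have "- divergence G x * T t x + deriv (\<lambda>s. T s x) t * u t x
      + 5/3 * (T t x * divergence G x + grad (T t) x \<bullet> G x) = 0"
    using energy[OF t, of x] by (simp add: u_def G_def)
  then have balance: "u t x * deriv (\<lambda>s. T s x) t + 2/3 * divergence G x * T t x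
      - 5 * \<alpha> / 3 * (grad (u t) x \<bullet> grad (T t) x) = 0"
    by (simp add: G_closure inner_commute algebra_simps)
  have "deriv (\<lambda>s. ln (u s x)) t = - divergence G x / u t x"
    using upos by (auto intro!: DERIV_imp_deriv derivative_eq_intros Du)
  then have "deriv (\<lambda>s. T s x) t - (2/3 * deriv (\<lambda>s. ln (u s x)) t) * T t x
      - ((5 * \<alpha> / 3) *\<^sub>R grad (\<lambda>y. ln (u t y)) x) \<bullet> grad (T t) x
    = (u t x * deriv (\<lambda>s. T s x) t + 2/3 * divergence G x * T t x
      - 5 * \<alpha> / 3 * (grad (u t) x \<bullet> grad (T t) x)) / u t x"
    using upos by (simp add: grad_ln[OF ux] field_simps)
  also have "\<dots> = 0"
    by (simp only: balance div_0)
  finally show "deriv (\<lambda>s. c_tot n c s x) t - \<alpha> * laplacian (c_tot n c t) x = 0 \<and>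
      deriv (\<lambda>s. T s x) t
        - (2/3 * deriv (\<lambda>s. ln (c_tot n c s x)) t) * T t x
        - ((5 * \<alpha> / 3) *\<^sub>R grad (\<lambda>y. ln (c_tot n c t y)) x) \<bullet> grad (T t) x = 0"
    using heat by (simp add: u_def)
qed

end
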